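(* Let $H\in(0,1)$. Let $B^1$ be a standard Brownian motion and $B^2_H$ a fractional Brownian motion with Hurst parameter $H$, independent of $B^1$. Let $q=q(x,t)$ be the density of the law of $\tilde I_H(t)=B^1(|B^2_H(t)|)$, $t>0$. Then $$t\frac{\partial q}{\partial t}=\frac{H}{2^2}\,t^{2H}\,\frac{\partial^4 q}{\partial x^4}+\frac{H\,t^{H}}{\sqrt{2\pi}}\,\frac{d^2}{dx^2}\delta(x),\qquad x\in\mathbb{R},\ t>0,$$ with $q(x,0)=\delta(x)$.
   Context: A fractional Brownian motion $B_H$ with Hurst parameter $H\in(0,1)$ is a centred Gaussian process with covariance $E\{B_H(s)B_H(t)\}=\frac12\left(|t|^{2H}+|s|^{2H}-|t-s|^{2H}\right)$. The density of $\tilde I_H(t)$ is $q(x,t)=2\int_0^\infty \frac{e^{-x^2/(2s)}}{\sqrt{2\pi s}}\,\frac{e^{-s^2/(2t^{2H})}}{\sqrt{2\pi t^{2H}}}\,ds$. $\delta$ is the Dirac delta at $0$ and $\frac{d^2}{dx^2}\delta=\delta''$ is the distribution with $\langle\phi,\delta''\rangle=\phi''(0)$ for every test function $\phi$; the equation, which contains this term, is understood in the sense of distributions in the variable $x$. The initial condition means that the law $q(x,t)\,dx$ converges weakly to the Dirac mass at $0$ as $t\to0^+$. *)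

theory Defs
  imports "HOL-Probability.Probability"
begin

text \<open>Processes are maps \<open>X t \<omega>\<close>, used only at times \<open>t \<ge> 0\<close>.\<close>

definition standard_brownian_motion :: "'a measure \<Rightarrow> (real \<Rightarrow> 'a \<Rightarrow> real) \<Rightarrow> bool" where
  "standard_brownian_motion M B \<longleftrightarrow>
     prob_space M \<and>
     (\<forall>t\<ge>0. B t \<in> borel_measurable M) \<and>
     (AE \<omega> in M. B 0 \<omega> = 0) \<and>
     (\<forall>n (\<tau> :: nat \<Rightarrow> real). 0 \<le> \<tau> 0 \<and> mono_on {..n} \<tau> \<longrightarrow>
        prob_space.indep_vars M (\<lambda>_. borel) (\<lambda>i \<omega>. B (\<tau> (Suc i)) \<omega> - B (\<tau> i) \<omega>) {..<n}) \<and>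
     (\<forall>s t. 0 \<le> s \<and> s < t \<longrightarrow>
        distributed M lborel (\<lambda>\<omega>. B t \<omega> - B s \<omega>)
          (\<lambda>x. ennreal (normal_density 0 (sqrt (t - s)) x))) \<and>
     (AE \<omega> in M. continuous_on {0..} (\<lambda>t. B t \<omega>))"

text \<open>The first alternative is the degenerate (variance zero) Gaussian law; it is needed because
  \<open>normal_density \<mu> 0\<close> is not a density.\<close>

definition gaussian_variable :: "'a measure \<Rightarrow> ('a \<Rightarrow> real) \<Rightarrow> bool" where
  "gaussian_variable M X \<longleftrightarrow>
     X \<in> borel_measurable M \<and>
     ((\<exists>\<mu>. AE \<omega> in M. X \<omega> = \<mu>) \<or>
      (\<exists>\<mu> \<sigma>. \<sigma> > 0 \<and> distributed M lborel X (\<lambda>x. ennreal (normal_density \<mu> \<sigma> x))))"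

definition gaussian_process :: "'a measure \<Rightarrow> (real \<Rightarrow> 'a \<Rightarrow> real) \<Rightarrow> bool" where
  "gaussian_process M X \<longleftrightarrow>
     prob_space M \<and>
     (\<forall>J c. finite J \<and> J \<subseteq> {0..} \<longrightarrow> gaussian_variable M (\<lambda>\<omega>. \<Sum>t\<in>J. c t * X t \<omega>))"

definition fractional_brownian_motion ::
    "'a measure \<Rightarrow> real \<Rightarrow> (real \<Rightarrow> 'a \<Rightarrow> real) \<Rightarrow> bool" where
  "fractional_brownian_motion M H B \<longleftrightarrow>
     gaussian_process M B \<and>
     (\<forall>t\<ge>0. integral\<^sup>L M (B t) = 0) \<and>
     (\<forall>s\<ge>0. \<forall>t\<ge>0. integral\<^sup>L M (\<lambda>\<omega>. B s \<omega> * B t \<omega>) =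
        1 / 2 * (\<bar>t\<bar> powr (2 * H) + \<bar>s\<bar> powr (2 * H) - \<bar>t - s\<bar> powr (2 * H)))"

text \<open>Independence of the two processes as random elements of path space, i.e. of the
  sigma-algebras they generate.\<close>

definition independent_processes ::
    "'a measure \<Rightarrow> (real \<Rightarrow> 'a \<Rightarrow> real) \<Rightarrow> (real \<Rightarrow> 'a \<Rightarrow> real) \<Rightarrow> bool" where
  "independent_processes M X Y \<longleftrightarrow>
     prob_space.indep_var M
       (Pi\<^sub>M {0..} (\<lambda>_. borel)) (\<lambda>\<omega>. \<lambda>t\<in>{0..}. X t \<omega>)
       (Pi\<^sub>M {0..} (\<lambda>_. borel)) (\<lambda>\<omega>. \<lambda>t\<in>{0..}. Y t \<omega>)"

definition test_function :: "(real \<Rightarrow> real) \<Rightarrow> bool" where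
  "test_function \<phi> \<longleftrightarrow>
     (\<forall>n x. (deriv ^^ n) \<phi> field_differentiable at x) \<and> compact (closure {x. \<phi> x \<noteq> 0})"

text \<open>Distributions on the real line are represented by their action on test functions; values on
  other functions carry no meaning, so distributions are only compared on test functions.\<close>

type_synonym distribution = "(real \<Rightarrow> real) \<Rightarrow> real"

definition regular_distribution :: "(real \<Rightarrow> real) \<Rightarrow> distribution" where
  "regular_distribution f \<phi> = (LINT x|lborel. f x * \<phi> x)"

definition dirac_delta :: distribution where
  "dirac_delta \<phi> = \<phi> 0"

definition distribution_deriv :: "distribution \<Rightarrow> distribution" where
  "distribution_deriv T \<phi> = - T (deriv \<phi>)"

definition eq_distribution :: "distribution \<Rightarrow> distribution \<Rightarrow> bool" where
  "eq_distribution S T \<longleftrightarrow> (\<forall>\<phi>. test_function \<phi> \<longrightarrow> S \<phi> = T \<phi>)"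

text \<open>Derivative with respect to the parameter of a one-parameter family of distributions,
  in the (weak) topology of the space of distributions.\<close>

definition has_param_derivative ::
    "(real \<Rightarrow> distribution) \<Rightarrow> distribution \<Rightarrow> real \<Rightarrow> bool" where
  "has_param_derivative T T' t \<longleftrightarrow>
     (\<forall>\<phi>. test_function \<phi> \<longrightarrow> ((\<lambda>s. T s \<phi>) has_real_derivative T' \<phi>) (at t))"

end

(* Write V f s = E f(sqrt s Z) with Z standard normal. Conditioning on the independent time gives
   E f(B1 |B2 t|) = E V f (t^H |N|) with N standard normal. Stein's identity yields the heat
   equation (V f)' = V f'' / 2. For F(sigma) = E V f (sigma |N|) one therefore has
   F'(sigma) = E |N| V f'' (sigma |N|) / 2, and integrating the factor |n| against the Gaussian
   density by parts over the half line gives f''(0) / sqrt (2 pi), the boundary term at 0 that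
   becomes the delta'' source, plus sigma / 4 * E V f^(4) (sigma |N|). The chain rule with
   sigma = t^H is the stated equation. *)

theory Submission imports Defs "HOL-Real_Asymp.Real_Asymp" begin

text \<open>The density is never differentiated: \<open>q\<close> enters only through its pairing
  with a bounded continuous function, which is an expectation, so every derivative falls on the test
  function. The fourth order and the constant 1/4 have one origin: the Brownian time
  \<open>\<sigma> * \<bar>n\<bar>\<close> is a variance, so differentiating in it costs two space
  derivatives and a factor 1/2, and this happens twice, once for the derivative in
  \<open>\<sigma>\<close> and once in the integration by parts. The obstacle is the origin. There
  \<open>\<bar>n\<bar>\<close> has a kink, which forces the half line, and the heat equation is
  obtained only for positive variance, since \<open>sqrt\<close> is not differentiable at 0. Hence
  the half-line formula asks for a derivative on the open half line and mere continuity up to 0. The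
  identity for the expectation holds for all bounded continuous functions, so it also yields the
  initial condition, where continuous step functions replace test functions and
  \<open>gaussian_mean f\<close> tends to its value \<open>f 0\<close>.\<close>

section \<open>Differentiation under the integral sign\<close>

text \<open>Dominated convergence along sequences of difference quotients: the mean value inequality
  turns the bound \<open>h\<close> on the derivative into the same bound on every quotient,
  uniformly in the increment.\<close>

lemma has_real_derivative_integral:
  fixes f :: "real \<Rightarrow> 'a \<Rightarrow> real"
  assumes t: "t \<in> {a<..<b}"
    and int: "\<And>s. s \<in> {a<..<b} \<Longrightarrow> integrable M (f s)"
    and deriv: "\<And>s x. s \<in> {a<..<b} \<Longrightarrow> x \<in> space M \<Longrightarrow> ((\<lambda>s. f s x) has_real_derivative f' s x) (at s)"
    and bound: "\<And>s x. s \<in> {a<..<b} \<Longrightarrow> x \<in> space M \<Longrightarrow> \<bar>f' s x\<bar> \<le> h x"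
    and meas: "f' t \<in> borel_measurable M"
    and h: "integrable M h"
  shows "((\<lambda>s. \<integral>x. f s x \<partial>M) has_real_derivative (\<integral>x. f' t x \<partial>M)) (at t)"
proof -
  have "((\<lambda>y. ((\<integral>x. f y x \<partial>M) - (\<integral>x. f t x \<partial>M)) / (y - t)) \<longlongrightarrow> (\<integral>x. f' t x \<partial>M))
          (at t within {a<..<b})"
    unfolding tendsto_at_iff_sequentially
  proof (intro allI impI)
    fix X :: "nat \<Rightarrow> real"
    assume X: "\<forall>i. X i \<in> {a<..<b} - {t}" and lim: "X \<longlonglongrightarrow> t"
    then have Xi: "X i \<in> {a<..<b}" "X i \<noteq> t" for i
      by auto
    have "(\<lambda>i. \<integral>x. (f (X i) x - f t x) / (X i - t) \<partial>M) \<longlonglongrightarrow> (\<integral>x. f' t x \<partial>M)"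
    proof (rule integral_dominated_convergence[where w = h])
      show "AE x in M. (\<lambda>i. (f (X i) x - f t x) / (X i - t)) \<longlonglongrightarrow> f' t x"
      proof (rule AE_I2)
        fix x assume "x \<in> space M"
        from deriv[OF t this] have "((\<lambda>y. (f y x - f t x) / (y - t)) \<longlongrightarrow> f' t x) (at t)"
          by (simp add: has_field_derivative_iff)
        then show "(\<lambda>i. (f (X i) x - f t x) / (X i - t)) \<longlonglongrightarrow> f' t x"
          using Xi lim by (simp add: tendsto_at_iff_sequentially comp_def)
      qed
      show "AE x in M. norm ((f (X i) x - f t x) / (X i - t)) \<le> h x" for i
      proof (rule AE_I2)
        fix x assume x: "x \<in> space M"
        have "norm (f (X i) x - f t x) \<le> h x * norm (X i - t)"
          by (rule field_differentiable_bound[where S = "{a<..<b}" and f' = "\<lambda>s. f' s x"])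
            (use Xi t x deriv bound in \<open>auto intro: has_field_derivative_at_within\<close>)
        then show "norm ((f (X i) x - f t x) / (X i - t)) \<le> h x"
          using Xi(2)[of i] by (simp add: field_simps)
      qed
    qed (use meas h borel_measurable_integrable[OF int] t Xi in auto)
    moreover have "(\<integral>x. (f (X i) x - f t x) / (X i - t) \<partial>M)
        = ((\<integral>x. f (X i) x \<partial>M) - (\<integral>x. f t x \<partial>M)) / (X i - t)" for i
      by (simp only: integral_divide_zero Bochner_Integration.integral_diff[OF int[OF Xi(1)] int[OF t]])
    ultimately show "((\<lambda>y. ((\<integral>x. f y x \<partial>M) - (\<integral>x. f t x \<partial>M)) / (y - t)) \<circ> X)
        \<longlonglongrightarrow> (\<integral>x. f' t x \<partial>M)"
      by (simp only: comp_def)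
  qed
  then show ?thesis
    using t by (simp add: has_field_derivative_iff at_within_open[OF t open_greaterThanLessThan])
qed

section \<open>Integration by parts against the Gaussian density\<close>

lemma has_real_derivative_std_normal_density:
  "(std_normal_density has_real_derivative - x * std_normal_density x) (at x)"
proof -
  have "((\<lambda>x. 1 / sqrt (2 * pi) * exp (- x\<^sup>2 / 2)) has_real_derivative
      1 / sqrt (2 * pi) * (exp (- x\<^sup>2 / 2) * (- x))) (at x)"
    by (rule DERIV_cmult) (auto intro!: derivative_eq_intros)
  then show ?thesis
    by (simp add: std_normal_density_def[abs_def] mult_ac)
qed

lemma continuous_on_std_normal_density [continuous_intros]:
  "continuous_on A std_normal_density"
  by (meson DERIV_continuous continuous_at_imp_continuous_on has_real_derivative_std_normal_density)

lemma std_normal_density_tendsto_0: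
  "(std_normal_density \<longlongrightarrow> 0) at_top" "(std_normal_density \<longlongrightarrow> 0) at_bot"
  unfolding std_normal_density_def by real_asymp+

lemma std_normal_density_mult_tendsto_0:
  assumes "(std_normal_density \<longlongrightarrow> 0) F" and bound: "\<And>x. \<bar>f x\<bar> \<le> C"
  shows "((\<lambda>x. std_normal_density x * f x) \<longlongrightarrow> 0) F"
  by (rule tendsto_0_le[OF assms(1), where K = C])
    (auto simp: abs_mult intro!: always_eventually mult_left_mono bound)

text \<open>The density has derivative \<open>- x * std_normal_density x\<close>, so a factor
  \<open>x\<close> is absorbed by the fundamental theorem of calculus applied to density times
  \<open>f\<close>. Extended real endpoints let one statement serve both the whole line, where the
  boundary limits \<open>A\<close> and \<open>B\<close> vanish, and the half line, where
  \<open>A\<close> survives. Differentiability is asked for only inside the interval because the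
  half-line application has no derivative at 0.\<close>

lemma gaussian_integration_by_parts:
  fixes f f' :: "real \<Rightarrow> real" and a b :: ereal
  assumes "a < b"
    and deriv: "\<And>x. a < ereal x \<Longrightarrow> ereal x < b \<Longrightarrow> (f has_real_derivative f' x) (at x)"
    and cont: "continuous_on (einterval a b) f'"
    and bound: "\<And>x. \<bar>f x\<bar> \<le> C" and bound': "\<And>x. \<bar>f' x\<bar> \<le> C'"
    and A: "(((\<lambda>x. std_normal_density x * f x) \<circ> real_of_ereal) \<longlongrightarrow> A) (at_right a)"
    and B: "(((\<lambda>x. std_normal_density x * f x) \<circ> real_of_ereal) \<longlongrightarrow> B) (at_left b)"
  shows "set_integrable lborel (einterval a b) (\<lambda>x. std_normal_density x * (x * f x))"
    and "set_integrable lborel (einterval a b) (\<lambda>x. std_normal_density x * f' x)"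
    and "(LBINT x:einterval a b. std_normal_density x * (x * f x))
        = A - B + (LBINT x:einterval a b. std_normal_density x * f' x)"
proof -
  have contf: "continuous_on (einterval a b) f"
    by (intro continuous_at_imp_continuous_on ballI DERIV_isCont[OF deriv])
      (auto simp: einterval_def)
  have dom: "set_integrable lborel (einterval a b) g"
    if "continuous_on (einterval a b) g" "\<And>x. \<bar>g x\<bar> \<le> h x" "integrable lborel h" for g h :: "real \<Rightarrow> real"
    unfolding set_integrable_def
  proof (rule Bochner_Integration.integrable_bound[OF that(3)])
    show "(\<lambda>x. indicator (einterval a b) x *\<^sub>R g x) \<in> borel_measurable lborel"
      using borel_measurable_continuous_on_indicator[OF _ that(1)] by simp
    show "AE x in lborel. norm (indicator (einterval a b) x *\<^sub>R g x) \<le> norm (h x)"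
      using that(2) by (intro AE_I2) (auto simp: indicator_def intro: order_trans[OF _ abs_ge_self])
  qed
  show 1: "set_integrable lborel (einterval a b) (\<lambda>x. std_normal_density x * (x * f x))"
  proof (rule dom)
    show "integrable lborel (\<lambda>x. std_normal_density x * \<bar>x\<bar> ^ 1 * C)"
      by (intro integrable_mult_left integrable_std_normal_moment_abs)
    show "\<bar>std_normal_density x * (x * f x)\<bar> \<le> std_normal_density x * \<bar>x\<bar> ^ 1 * C" for x
      using bound[of x] by (auto simp: abs_mult mult.assoc intro!: mult_left_mono)
  qed (intro continuous_intros contf)
  show 2: "set_integrable lborel (einterval a b) (\<lambda>x. std_normal_density x * f' x)"
  proof (rule dom)
    show "integrable lborel (\<lambda>x. std_normal_density x * C')"
      by (intro integrable_mult_left) simp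
    show "\<bar>std_normal_density x * f' x\<bar> \<le> std_normal_density x * C'" for x
      using bound'[of x] by (auto simp: abs_mult intro!: mult_left_mono)
  qed (intro continuous_intros cont)
  let ?g = "\<lambda>x. std_normal_density x * f' x - std_normal_density x * (x * f x)"
  have "(LBINT x=a..b. ?g x) = B - A"
  proof (rule interval_integral_FTC_integrable[OF \<open>a < b\<close> _ _ _ A B])
    fix x assume x: "a < ereal x" "ereal x < b"
    show "((\<lambda>x. std_normal_density x * f x) has_vector_derivative ?g x) (at x)"
      unfolding has_real_derivative_iff_has_vector_derivative[symmetric]
      by (auto intro!: derivative_eq_intros deriv[OF x] has_real_derivative_std_normal_density
          simp: algebra_simps)
    have "continuous_on (einterval a b) ?g"
      by (intro continuous_intros contf cont)
    then show "isCont ?g x"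
      using x by (simp add: continuous_on_eq_continuous_at einterval_iff)
  qed (use 1 2 in auto)
  then show "(LBINT x:einterval a b. std_normal_density x * (x * f x))
        = A - B + (LBINT x:einterval a b. std_normal_density x * f' x)"
    using \<open>a < b\<close> 1 2 by (simp add: interval_lebesgue_integral_def less_imp_le)
qed

lemma integral_std_normal_distribution:
  fixes f :: "real \<Rightarrow> real"
  assumes "f \<in> borel_measurable borel"
  shows "(\<integral>x. f x \<partial>std_normal_distribution) = (\<integral>x. std_normal_density x * f x \<partial>lborel)"
  using assms by (subst integral_density) auto

text \<open>Both boundary terms vanish, because the density decays at either end and
  \<open>f\<close> is bounded.\<close>

lemma stein_identity:
  fixes f f' :: "real \<Rightarrow> real"
  assumes deriv: "\<And>x. (f has_real_derivative f' x) (at x)"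
    and cont: "continuous_on UNIV f'"
    and bound: "\<And>x. \<bar>f x\<bar> \<le> C" and bound': "\<And>x. \<bar>f' x\<bar> \<le> C'"
  shows "(\<integral>x. x * f x \<partial>std_normal_distribution) = (\<integral>x. f' x \<partial>std_normal_distribution)"
proof -
  have contf: "continuous_on UNIV f"
    using deriv DERIV_isCont continuous_at_imp_continuous_on by blast
  note lim = std_normal_density_tendsto_0[THEN std_normal_density_mult_tendsto_0, OF bound]
  have "(LBINT x:einterval (-\<infinity>) \<infinity>. std_normal_density x * (x * f x))
      = 0 - 0 + (LBINT x:einterval (-\<infinity>) \<infinity>. std_normal_density x * f' x)"
    by (rule gaussian_integration_by_parts)
      (use deriv cont bound bound' lim in
        \<open>auto simp: ereal_tendsto_simps\<close>)
  moreover have "f' \<in> borel_measurable borel" "f \<in> borel_measurable borel"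
    using cont contf borel_measurable_continuous_onI by auto
  ultimately show ?thesis
    by (simp add: integral_std_normal_distribution set_lebesgue_integral_def)
qed

text \<open>Both integrands are even, so each integral is twice the one over the positive half line.
  The boundary term there is the value of the density at 0 times \<open>w 0\<close>; doubling it
  gives the constant \<open>2 / sqrt (2 * pi)\<close>.\<close>

lemma half_gaussian_integration_by_parts:
  fixes w w' :: "real \<Rightarrow> real"
  assumes deriv: "\<And>x. 0 < x \<Longrightarrow> (w has_real_derivative w' x) (at x)"
    and cont: "continuous_on {0..} w" and cont': "continuous_on {0..} w'"
    and bound: "\<And>x. \<bar>w x\<bar> \<le> C" and bound': "\<And>x. \<bar>w' x\<bar> \<le> C'"
  shows "(\<integral>x. \<bar>x\<bar> * w \<bar>x\<bar> \<partial>std_normal_distribution)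
      = 2 * w 0 / sqrt (2 * pi) + (\<integral>x. w' \<bar>x\<bar> \<partial>std_normal_distribution)"
proof -
  have int_even: "(\<integral>x. h \<bar>x\<bar> \<partial>std_normal_distribution)
      = 2 * (LBINT x:einterval 0 \<infinity>. std_normal_density x * h x)"
    if int: "set_integrable lborel (einterval 0 \<infinity>) (\<lambda>x. std_normal_density x * h x)"
      and h: "continuous_on {0..} h" for h
  proof -
    have meas: "(\<lambda>x. h \<bar>x\<bar>) \<in> borel_measurable borel"
      by (intro borel_measurable_continuous_onI continuous_on_compose2[OF h] continuous_intros) auto
    have "has_bochner_integral lborel
        (\<lambda>x. indicator {0..} x *\<^sub>R (std_normal_density x * h \<bar>x\<bar>))
        (LBINT x:einterval 0 \<infinity>. std_normal_density x * h x)"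
    proof (rule has_bochner_integralI_AE)
      show "has_bochner_integral lborel
          (\<lambda>x. indicator (einterval 0 \<infinity>) x *\<^sub>R (std_normal_density x * h x))
          (LBINT x:einterval 0 \<infinity>. std_normal_density x * h x)"
        using int by (simp add: has_bochner_integral_iff set_integrable_def set_lebesgue_integral_def)
      \<comment> \<open>The open interval, where integration by parts took place, and the closed
        half line of the rule for even functions differ only in the null set {0}; on both,
        \<open>\<bar>x\<bar>\<close> equals \<open>x\<close>.\<close>
      show "AE x in lborel. indicator (einterval 0 \<infinity>) x *\<^sub>R (std_normal_density x * h x)
          = indicator {0..} x *\<^sub>R (std_normal_density x * h \<bar>x\<bar>)"
        using AE_lborel_singleton[of "0::real"]
        by eventually_elim (auto simp: indicator_def einterval_iff)
    qed (use meas in measurable)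
    then have "has_bochner_integral lborel (\<lambda>x. std_normal_density x * h \<bar>x\<bar>)
        (2 *\<^sub>R (LBINT x:einterval 0 \<infinity>. std_normal_density x * h x))"
      by (rule has_bochner_integral_even_function) (simp add: normal_density_def)
    then show ?thesis
      by (simp add: integral_std_normal_distribution[OF meas] has_bochner_integral_integral_eq)
  qed
  have A: "(((\<lambda>x. std_normal_density x * w x) \<circ> real_of_ereal) \<longlongrightarrow> std_normal_density 0 * w 0) (at_right 0)"
  proof -
    have "continuous_on {0..} (\<lambda>x. std_normal_density x * w x)"
      by (intro continuous_intros cont)
    then have "((\<lambda>x. std_normal_density x * w x) \<longlongrightarrow> std_normal_density 0 * w 0) (at_right 0)"
      by (auto simp: continuous_on_def intro: tendsto_within_subset)
    then show ?thesis
      by (simp add: zero_ereal_def ereal_tendsto_simps)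
  qed
  have B: "(((\<lambda>x. std_normal_density x * w x) \<circ> real_of_ereal) \<longlongrightarrow> 0) (at_left \<infinity>)"
    unfolding ereal_tendsto_simps
    by (rule std_normal_density_mult_tendsto_0[OF std_normal_density_tendsto_0(1) bound])
  note ibp = gaussian_integration_by_parts[OF _ _ _ bound bound' A B]
  have c': "continuous_on (einterval 0 \<infinity>) w'"
    using cont' by (rule continuous_on_subset) (auto simp: einterval_iff)
  have 1: "set_integrable lborel (einterval 0 \<infinity>) (\<lambda>x. std_normal_density x * (x * w x))"
    by (rule ibp(1)) (use deriv c' in auto)
  have 2: "set_integrable lborel (einterval 0 \<infinity>) (\<lambda>x. std_normal_density x * w' x)"
    by (rule ibp(2)) (use deriv c' in auto)
  have 3: "(LBINT x:einterval 0 \<infinity>. std_normal_density x * (x * w x))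
      = std_normal_density 0 * w 0 - 0 + (LBINT x:einterval 0 \<infinity>. std_normal_density x * w' x)"
    by (rule ibp(3)) (use deriv c' in auto)
  show ?thesis
    unfolding int_even[OF 1 continuous_on_mult[OF continuous_on_id cont]] int_even[OF 2 cont']
    using 3 by (simp add: std_normal_density_def)
qed


section \<open>The heat semigroup and its average over the random time\<close>

text \<open>The heat semigroup of half the second derivative, evaluated at the space point 0;
  \<open>s\<close> is the variance, that is, the Brownian time. As \<open>sqrt\<close> is odd and
  continuous on the whole line, bounds and continuity hold without the side condition that
  \<open>s\<close> is nonnegative.\<close>

definition gaussian_mean :: "(real \<Rightarrow> real) \<Rightarrow> real \<Rightarrow> real" where
  "gaussian_mean f s = (\<integral>z. f (sqrt s * z) \<partial>std_normal_distribution)"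

lemma gaussian_mean_0 [simp]: "gaussian_mean f 0 = f 0"
proof -
  interpret prob_space std_normal_distribution
    using real_dist_normal_dist by (simp add: real_distribution_def)
  show ?thesis
    using prob_space by (simp add: gaussian_mean_def)
qed

lemma integrable_std_normal_distribution_bounded:
  fixes f :: "real \<Rightarrow> real"
  assumes "f \<in> borel_measurable borel" and "\<And>x. \<bar>f x\<bar> \<le> C"
  shows "integrable std_normal_distribution f"
proof -
  interpret prob_space std_normal_distribution
    using real_dist_normal_dist by (simp add: real_distribution_def)
  show ?thesis
    by (rule integrable_const_bound[where B = C]) (use assms in auto)
qed

lemma integrable_std_normal_distribution_abs:
  "integrable std_normal_distribution (\<lambda>z. \<bar>z\<bar>)"
  using integrable_std_normal_moment_abs[of 1] by (simp add: integrable_density)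

lemma gaussian_mean_bound:
  assumes "\<And>x. \<bar>f x\<bar> \<le> C"
  shows "\<bar>gaussian_mean f s\<bar> \<le> C"
proof -
  interpret prob_space std_normal_distribution
    using real_dist_normal_dist by (simp add: real_distribution_def)
  have "0 \<le> C"
    using assms[of 0] by linarith
  have "norm (gaussian_mean f s) \<le> (\<integral>z. C \<partial>std_normal_distribution)"
    unfolding gaussian_mean_def
  proof (cases "integrable std_normal_distribution (\<lambda>z. f (sqrt s * z))")
    case True
    then show "norm (\<integral>z. f (sqrt s * z) \<partial>std_normal_distribution) \<le> (\<integral>z. C \<partial>std_normal_distribution)"
      by (rule Bochner_Integration.integral_norm_bound_integral) (use assms in auto)
  next
    \<comment> \<open>Measurability of \<open>f\<close> is not assumed; a non-integrable integrand
      has Bochner integral 0 by convention, which is at most \<open>C\<close>.\<close>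
    case False
    then show "norm (\<integral>z. f (sqrt s * z) \<partial>std_normal_distribution) \<le> (\<integral>z. C \<partial>std_normal_distribution)"
      using \<open>0 \<le> C\<close> by (simp add: not_integrable_integral_eq)
  qed
  then show ?thesis
    using prob_space by simp
qed

lemma continuous_on_gaussian_mean:
  assumes cont: "continuous_on UNIV f" and bound: "\<And>x. \<bar>f x\<bar> \<le> C"
  shows "continuous_on UNIV (gaussian_mean f)"
proof -
  interpret prob_space std_normal_distribution
    using real_dist_normal_dist by (simp add: real_distribution_def)
  have [measurable]: "f \<in> borel_measurable borel"
    using cont by (rule borel_measurable_continuous_onI)
  show ?thesis
    unfolding continuous_on_sequentially
  proof (intro allI ballI impI, elim conjE)
    fix X :: "nat \<Rightarrow> real" and s assume lim: "X \<longlonglongrightarrow> s"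
    show "(gaussian_mean f \<circ> X) \<longlonglongrightarrow> gaussian_mean f s"
      unfolding gaussian_mean_def comp_def
    proof (rule integral_dominated_convergence[where w = "\<lambda>_. C"])
      show "AE z in std_normal_distribution. (\<lambda>n. f (sqrt (X n) * z)) \<longlonglongrightarrow> f (sqrt s * z)"
        by (intro AE_I2 continuous_on_tendsto_compose[OF cont] tendsto_intros lim) auto
    qed (use bound in auto)
  qed
qed

text \<open>Differentiating \<open>f (sqrt s * z)\<close> produces the factor
  \<open>z / (2 * sqrt s)\<close>. Stein's identity trades \<open>z\<close> for one more derivative,
  whose inner factor \<open>sqrt s\<close> cancels the denominator and leaves 1/2.\<close>

lemma has_real_derivative_gaussian_mean:
  assumes f: "\<And>x. (f has_real_derivative f' x) (at x)"
    and f': "\<And>x. (f' has_real_derivative f'' x) (at x)"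
    and cont: "continuous_on UNIV f''"
    and bound: "\<And>x. \<bar>f x\<bar> \<le> C" "\<And>x. \<bar>f' x\<bar> \<le> C'" "\<And>x. \<bar>f'' x\<bar> \<le> C''"
    and "0 < s"
  shows "(gaussian_mean f has_real_derivative gaussian_mean f'' s / 2) (at s)"
proof -
  have contf: "continuous_on UNIV f" "continuous_on UNIV f'"
    by (intro continuous_at_imp_continuous_on ballI DERIV_isCont[OF f] DERIV_isCont[OF f'])+
  have [measurable]: "f \<in> borel_measurable borel" "f' \<in> borel_measurable borel"
    by (intro borel_measurable_continuous_onI contf)+
  have "0 \<le> C'"
    using bound(2)[of 0] by linarith
  let ?D = "\<lambda>s z. f' (sqrt s * z) * (z / (2 * sqrt s))"
  have "((\<lambda>s. gaussian_mean f s) has_real_derivative (\<integral>z. ?D s z \<partial>std_normal_distribution)) (at s)"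
    unfolding gaussian_mean_def
  \<comment> \<open>The window stays away from 0, where \<open>1 / (2 * sqrt r)\<close> blows up;
    its left endpoint gives the constant in the dominating function.\<close>
  proof (rule has_real_derivative_integral[where a = "s / 2" and b = "2 * s"
        and h = "\<lambda>z. C' / (2 * sqrt (s / 2)) * \<bar>z\<bar>"])
    show "((\<lambda>s. f (sqrt s * z)) has_real_derivative ?D r z) (at r)" if "r \<in> {s / 2<..<2 * s}" for r z
    proof -
      have "((\<lambda>s. sqrt s * z) has_real_derivative z / (2 * sqrt r)) (at r)"
        by (rule DERIV_cong[OF DERIV_cmult_right[OF DERIV_real_sqrt]])
          (use that \<open>0 < s\<close> in \<open>simp_all add: field_simps\<close>)
      then show ?thesis
        by (rule DERIV_chain2[OF f])
    qed
    show "\<bar>?D r z\<bar> \<le> C' / (2 * sqrt (s / 2)) * \<bar>z\<bar>" if r: "r \<in> {s / 2<..<2 * s}" for r z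
    proof -
      have "\<bar>?D r z\<bar> = \<bar>f' (sqrt r * z)\<bar> * (\<bar>z\<bar> / (2 * sqrt r))"
        using r \<open>0 < s\<close> by (simp add: abs_mult)
      also have "\<dots> \<le> C' * (\<bar>z\<bar> / (2 * sqrt (s / 2)))"
        by (rule mult_mono) (use r \<open>0 < s\<close> \<open>0 \<le> C'\<close> bound(2) in \<open>auto intro!: frac_le\<close>)
      finally show ?thesis
        by simp
    qed
    show "integrable std_normal_distribution (\<lambda>z. C' / (2 * sqrt (s / 2)) * \<bar>z\<bar>)"
      by (intro integrable_mult_right integrable_std_normal_distribution_abs)
    show "integrable std_normal_distribution (\<lambda>z. f (sqrt r * z))" for r
      by (rule integrable_std_normal_distribution_bounded[OF _ bound(1)]) measurable
  qed (use \<open>0 < s\<close> in \<open>simp, measurable\<close>)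
  also have "(\<integral>z. ?D s z \<partial>std_normal_distribution)
      = (\<integral>z. z * f' (sqrt s * z) \<partial>std_normal_distribution) / (2 * sqrt s)"
    unfolding integral_divide_zero[symmetric] by (simp add: mult_ac)
  also have "(\<integral>z. z * f' (sqrt s * z) \<partial>std_normal_distribution)
      = (\<integral>z. f'' (sqrt s * z) * sqrt s \<partial>std_normal_distribution)"
  proof (rule stein_identity[where C = C' and C' = "C'' * sqrt s"])
    show "((\<lambda>z. f' (sqrt s * z)) has_real_derivative f'' (sqrt s * z) * sqrt s) (at z)" for z
      by (rule DERIV_chain2[OF f' DERIV_cmult_Id])
    show "continuous_on UNIV (\<lambda>z. f'' (sqrt s * z) * sqrt s)"
      by (intro continuous_intros continuous_on_compose2[OF cont]) auto
    show "\<bar>f'' (sqrt s * z) * sqrt s\<bar> \<le> C'' * sqrt s" for z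
      using bound(3) \<open>0 < s\<close> by (simp add: abs_mult mult_right_mono)
  qed (rule bound)
  also have "\<dots> / (2 * sqrt s) = gaussian_mean f'' s / 2"
    using \<open>0 < s\<close> by (simp add: gaussian_mean_def)
  finally show ?thesis .
qed

text \<open>The function comes as the sequence \<open>f n\<close> of its successive derivatives,
  each bounded, so that the heat equation can be applied at level 0 and again at level 2.\<close>

lemma has_real_derivative_gaussian_mean_abs:
  fixes f :: "nat \<Rightarrow> real \<Rightarrow> real"
  assumes f: "\<And>n x. (f n has_real_derivative f (Suc n) x) (at x)"
    and bound: "\<And>n x. \<bar>f n x\<bar> \<le> C n"
    and "0 < \<sigma>"
  shows "((\<lambda>\<sigma>. \<integral>n. gaussian_mean (f 0) (\<sigma> * \<bar>n\<bar>) \<partial>std_normal_distribution) has_real_derivative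
      f 2 0 / sqrt (2 * pi) + \<sigma> / 4 * (\<integral>n. gaussian_mean (f 4) (\<sigma> * \<bar>n\<bar>) \<partial>std_normal_distribution))
      (at \<sigma>)"
proof -
  have cont: "continuous_on UNIV (f n)" for n
    using f DERIV_isCont continuous_at_imp_continuous_on by blast
  have cont_mean: "continuous_on A (\<lambda>x. gaussian_mean (f n) (g x))" if "continuous_on A g"
    for A :: "real set" and g n
    by (rule continuous_on_compose2[OF continuous_on_gaussian_mean[OF cont bound] that]) auto
  have deriv: "(gaussian_mean (f n) has_real_derivative gaussian_mean (f (n + 2)) s / 2) (at s)"
    if "0 < s" for n s
    using has_real_derivative_gaussian_mean[OF f f cont bound bound bound that, of n] by simp
  have meas [measurable]: "gaussian_mean (f n) \<in> borel_measurable borel" for n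
    by (intro borel_measurable_continuous_onI cont_mean continuous_intros)
  have mean_bound: "\<bar>gaussian_mean (f n) s\<bar> \<le> C n" for n s
    by (rule gaussian_mean_bound) (rule bound)
  let ?D = "\<lambda>\<sigma> n. \<bar>n\<bar> * (gaussian_mean (f 2) (\<sigma> * \<bar>n\<bar>) / 2)"
  have "((\<lambda>\<sigma>. \<integral>n. gaussian_mean (f 0) (\<sigma> * \<bar>n\<bar>) \<partial>std_normal_distribution) has_real_derivative
      (\<integral>n. ?D \<sigma> n \<partial>std_normal_distribution)) (at \<sigma>)"
  proof (rule has_real_derivative_integral[where a = 0 and b = "2 * \<sigma>" and h = "\<lambda>n. C 2 / 2 * \<bar>n\<bar>"])
    show "((\<lambda>\<sigma>. gaussian_mean (f 0) (\<sigma> * \<bar>n\<bar>)) has_real_derivative ?D r n) (at r)"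
      if "r \<in> {0<..<2 * \<sigma>}" for r n
    proof (cases "n = 0")
      case False
      then have "0 < r * \<bar>n\<bar>"
        using that by simp
      from DERIV_chain2[OF deriv[OF this, of 0] DERIV_cmult_right[OF DERIV_ident]] show ?thesis
        by (simp add: mult.commute numeral_2_eq_2)
    qed simp
    show "\<bar>?D r n\<bar> \<le> C 2 / 2 * \<bar>n\<bar>" for r n
      using mult_left_mono[OF mean_bound[of 2 "r * \<bar>n\<bar>"], of "\<bar>n\<bar>"]
      by (simp add: abs_mult mult_ac)
    show "integrable std_normal_distribution (\<lambda>n. C 2 / 2 * \<bar>n\<bar>)"
      by (intro integrable_mult_right integrable_std_normal_distribution_abs)
    show "integrable std_normal_distribution (\<lambda>n. gaussian_mean (f 0) (r * \<bar>n\<bar>))" for r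
      by (rule integrable_std_normal_distribution_bounded[OF _ mean_bound]) measurable
  qed (use \<open>0 < \<sigma>\<close> in \<open>simp, measurable\<close>)
  also have "(\<integral>n. ?D \<sigma> n \<partial>std_normal_distribution)
      = (\<integral>n. \<bar>n\<bar> * gaussian_mean (f 2) (\<sigma> * \<bar>n\<bar>) \<partial>std_normal_distribution) / 2"
    unfolding integral_divide_zero[symmetric] by simp
  also have "(\<integral>n. \<bar>n\<bar> * gaussian_mean (f 2) (\<sigma> * \<bar>n\<bar>) \<partial>std_normal_distribution)
      = 2 * gaussian_mean (f 2) (\<sigma> * 0) / sqrt (2 * pi)
        + (\<integral>n. \<sigma> * (gaussian_mean (f 4) (\<sigma> * \<bar>n\<bar>) / 2) \<partial>std_normal_distribution)"
  proof (rule half_gaussian_integration_by_parts[where C = "C 2" and C' = "\<sigma> * (C 4 / 2)"])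
    show "((\<lambda>x. gaussian_mean (f 2) (\<sigma> * x)) has_real_derivative
        \<sigma> * (gaussian_mean (f 4) (\<sigma> * x) / 2)) (at x)" if "0 < x" for x
    proof -
      have "0 < \<sigma> * x"
        using that \<open>0 < \<sigma>\<close> by simp
      from DERIV_chain2[OF deriv[OF this, of 2] DERIV_cmult_Id] show ?thesis
        by (simp add: mult.commute)
    qed
    show "\<bar>\<sigma> * (gaussian_mean (f 4) (\<sigma> * x) / 2)\<bar> \<le> \<sigma> * (C 4 / 2)" for x
      using \<open>0 < \<sigma>\<close> mean_bound[of 4 "\<sigma> * x"] by (simp add: abs_mult)
  qed (intro mean_bound continuous_intros cont_mean; simp)+
  \<comment> \<open>The outer 1/2 cancels the 2 of the boundary term and combines with the inner 1/2
    to give \<open>\<sigma> / 4\<close>.\<close>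
  finally show ?thesis
    by (simp add: field_simps)
qed

section \<open>Laws of the two processes and of their composition\<close>

lemma (in prob_space) integral_centered_normal:
  fixes f :: "real \<Rightarrow> real"
  assumes X: "distributed M lborel X (\<lambda>x. ennreal (normal_density 0 \<sigma> x))" and "0 < \<sigma>"
    and [measurable]: "f \<in> borel_measurable borel"
  shows "expectation (\<lambda>\<omega>. f (X \<omega>)) = (\<integral>z. f (\<sigma> * z) \<partial>std_normal_distribution)"
proof -
  have "expectation (\<lambda>\<omega>. f (X \<omega>)) = (\<integral>x. normal_density 0 \<sigma> x * f x \<partial>lborel)"
    by (rule distributed_integral[OF X, symmetric]) auto
  also have "\<dots> = \<bar>\<sigma>\<bar> *\<^sub>R (\<integral>z. normal_density 0 \<sigma> (0 + \<sigma> * z) * f (0 + \<sigma> * z) \<partial>lborel)"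
    using \<open>0 < \<sigma>\<close> by (intro lborel_integral_real_affine) simp
  also have "\<dots> = (\<integral>z. \<sigma> * (normal_density 0 \<sigma> (\<sigma> * z) * f (\<sigma> * z)) \<partial>lborel)"
    using \<open>0 < \<sigma>\<close> by simp
  also have "(\<lambda>z. \<sigma> * (normal_density 0 \<sigma> (\<sigma> * z) * f (\<sigma> * z)))
      = (\<lambda>z. std_normal_density z * f (\<sigma> * z))"
    using \<open>0 < \<sigma>\<close>
    by (auto simp: normal_density_def power_mult_distrib real_sqrt_mult field_simps)
  also have "(\<integral>z. std_normal_density z * f (\<sigma> * z) \<partial>lborel)
      = (\<integral>z. f (\<sigma> * z) \<partial>std_normal_distribution)"
    by (rule integral_std_normal_distribution[symmetric]) measurable
  finally show ?thesis .
qed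

lemma brownian_motion_expectation:
  fixes f :: "real \<Rightarrow> real"
  assumes B: "standard_brownian_motion M B" and "0 \<le> s"
    and f[measurable]: "f \<in> borel_measurable borel"
  shows "(\<integral>\<omega>. f (B s \<omega>) \<partial>M) = gaussian_mean f s"
proof -
  interpret prob_space M
    using B by (simp add: standard_brownian_motion_def)
  have zero: "AE \<omega> in M. B 0 \<omega> = 0"
    and [measurable]: "B s \<in> borel_measurable M" "B 0 \<in> borel_measurable M"
    using B \<open>0 \<le> s\<close> by (auto simp: standard_brownian_motion_def)
  show ?thesis
  proof (cases "s = 0")
    \<comment> \<open>The definition gives a density only to increments of positive length, so time
      0 rests on the almost sure value of \<open>B 0\<close>.\<close>
    case True
    have "(\<integral>\<omega>. f (B s \<omega>) \<partial>M) = (\<integral>\<omega>. f 0 \<partial>M)"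
      by (rule integral_cong_AE) (use zero True in auto)
    then show ?thesis
      using True prob_space by simp
  next
    case False
    with \<open>0 \<le> s\<close> have "0 < s"
      by simp
    with B have "distributed M lborel (\<lambda>\<omega>. B s \<omega> - B 0 \<omega>)
        (\<lambda>x. ennreal (normal_density 0 (sqrt (s - 0)) x))"
      unfolding standard_brownian_motion_def by blast
    then have "expectation (\<lambda>\<omega>. f (B s \<omega> - B 0 \<omega>)) = gaussian_mean f s"
      unfolding gaussian_mean_def using \<open>0 < s\<close> by (intro integral_centered_normal) auto
    moreover have "(\<integral>\<omega>. f (B s \<omega>) \<partial>M) = expectation (\<lambda>\<omega>. f (B s \<omega> - B 0 \<omega>))"
      by (rule integral_cong_AE) (use zero in auto)
    ultimately show ?thesis
      by simp
  qed
qed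

lemma fractional_brownian_motion_measurable:
  assumes "fractional_brownian_motion M H B" and "0 \<le> t"
  shows "B t \<in> borel_measurable M"
proof -
  have "gaussian_variable M (\<lambda>\<omega>. \<Sum>s\<in>{t}. 1 * B s \<omega>)"
    using assms unfolding fractional_brownian_motion_def gaussian_process_def
    by (elim conjE allE[of _ "{t}"] allE[of _ "\<lambda>_. 1"]) auto
  then show ?thesis
    by (simp add: gaussian_variable_def)
qed

text \<open>A one-point linear combination makes \<open>B t\<close> itself Gaussian, and a Gaussian
  law is fixed by its first two moments. The covariance on the diagonal gives the second moment
  \<open>(t powr H)\<^sup>2\<close>.\<close>

lemma fractional_brownian_motion_expectation:
  fixes f :: "real \<Rightarrow> real"
  assumes B: "fractional_brownian_motion M H B" and "0 < t"
    and f[measurable]: "f \<in> borel_measurable borel"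
  shows "(\<integral>\<omega>. f (B t \<omega>) \<partial>M) = (\<integral>n. f (t powr H * n) \<partial>std_normal_distribution)"
proof -
  interpret prob_space M
    using B by (simp add: fractional_brownian_motion_def gaussian_process_def)
  have [measurable]: "B t \<in> borel_measurable M"
    using B \<open>0 < t\<close> by (simp add: fractional_brownian_motion_measurable)
  from B have "\<And>t. 0 \<le> t \<Longrightarrow> expectation (B t) = 0"
    and "\<And>s t. 0 \<le> s \<Longrightarrow> 0 \<le> t \<Longrightarrow> expectation (\<lambda>\<omega>. B s \<omega> * B t \<omega>)
      = 1 / 2 * (\<bar>t\<bar> powr (2 * H) + \<bar>s\<bar> powr (2 * H) - \<bar>t - s\<bar> powr (2 * H))"
    by (auto simp only: fractional_brownian_motion_def)
  from this(1)[of t] this(2)[of t t] \<open>0 < t\<close>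
  have "expectation (\<lambda>\<omega>. B t \<omega> * B t \<omega>)
      = 1 / 2 * (\<bar>t\<bar> powr (2 * H) + \<bar>t\<bar> powr (2 * H) - \<bar>t - t\<bar> powr (2 * H))"
    and mean: "expectation (B t) = 0"
    by auto
  then have second: "expectation (\<lambda>\<omega>. (B t \<omega>)\<^sup>2) = (t powr H)\<^sup>2"
    using \<open>0 < t\<close> by (simp add: power2_eq_square powr_add[symmetric])
  have "gaussian_variable M (\<lambda>\<omega>. \<Sum>s\<in>{t}. 1 * B s \<omega>)"
    using B \<open>0 < t\<close> unfolding fractional_brownian_motion_def gaussian_process_def
    by (elim conjE allE[of _ "{t}"] allE[of _ "\<lambda>_. 1"]) auto
  then consider (degenerate) \<mu> where "AE \<omega> in M. B t \<omega> = \<mu>"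
    | (normal) \<mu> \<sigma> where "0 < \<sigma>" "distributed M lborel (B t) (\<lambda>x. ennreal (normal_density \<mu> \<sigma> x))"
    by (auto simp: gaussian_variable_def)
  then show ?thesis
  proof cases
    \<comment> \<open>A constant with mean 0 has second moment 0, contradicting the positive value
      found above.\<close>
    case degenerate
    have "expectation (B t) = expectation (\<lambda>\<omega>. \<mu>)"
      "expectation (\<lambda>\<omega>. (B t \<omega>)\<^sup>2) = expectation (\<lambda>\<omega>. \<mu>\<^sup>2)"
      by (rule integral_cong_AE; use degenerate in auto)+
    then show ?thesis
      using mean second \<open>0 < t\<close> by (simp add: prob_space)
  next
    case normal
    have "\<mu> = 0"
      using normal_distributed_expectation[OF normal] mean by simp
    moreover have "\<sigma>\<^sup>2 = (t powr H)\<^sup>2"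
      using normal_distributed_variance[OF normal] mean second by simp
    then have "\<sigma> = t powr H"
      using \<open>0 < \<sigma>\<close> by (simp add: power2_eq_iff_nonneg)
    ultimately show ?thesis
      using normal by (intro integral_centered_normal) auto
  qed
qed

text \<open>The random time is \<open>h (Y \<omega>)\<close> for a path-valued \<open>Y\<close> because \<open>indep_var\<close> forces both variables to
  have the same type.\<close>

lemma brownian_motion_at_independent_time:
  fixes f :: "real \<Rightarrow> real" and B :: "real \<Rightarrow> 'a \<Rightarrow> real" 
    and Y :: "'a \<Rightarrow> real \<Rightarrow> real" and h :: "(real \<Rightarrow> real) \<Rightarrow> real"
  assumes B: "standard_brownian_motion M B"
    and indep: "prob_space.indep_var M (Pi\<^sub>M {0..} (\<lambda>_. borel)) (\<lambda>\<omega>. \<lambda>t\<in>{0..}. B t \<omega>) T Y"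
    and h[measurable]: "h \<in> borel_measurable T" and nonneg: "\<And>y. 0 \<le> h y"
    and X[measurable]: "(\<lambda>\<omega>. B (h (Y \<omega>)) \<omega>) \<in> borel_measurable M"
    and cont: "continuous_on UNIV f" and bound: "\<And>x. \<bar>f x\<bar> \<le> C"
  shows "(\<integral>\<omega>. f (B (h (Y \<omega>)) \<omega>) \<partial>M) = (\<integral>\<omega>. gaussian_mean f (h (Y \<omega>)) \<partial>M)"
proof -
  interpret prob_space M
    using B by (simp add: standard_brownian_motion_def)
  let ?S = "Pi\<^sub>M {0..} (\<lambda>_. borel) :: (real \<Rightarrow> real) measure"
  let ?path = "\<lambda>\<omega>. \<lambda>t\<in>{0..}. B t \<omega>"
  have path[measurable]: "?path \<in> M \<rightarrow>\<^sub>M ?S" and Y[measurable]: "Y \<in> M \<rightarrow>\<^sub>M T"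
    and joint: "distr M ?S ?path \<Otimes>\<^sub>M distr M T Y = distr M (?S \<Otimes>\<^sub>M T) (\<lambda>\<omega>. (?path \<omega>, Y \<omega>))"
    using indep unfolding indep_var_distribution_eq by auto
  have paths: "AE \<omega> in M. continuous_on {0..} (\<lambda>t. B t \<omega>)"
    using B by (simp add: standard_brownian_motion_def)
  have f[measurable]: "f \<in> borel_measurable borel"
    using cont by (rule borel_measurable_continuous_onI)
  have cont_mean: "continuous_on UNIV (gaussian_mean f)"
    by (rule continuous_on_gaussian_mean[OF cont bound])
  have [measurable]: "gaussian_mean f \<in> borel_measurable borel"
    using cont_mean by (rule borel_measurable_continuous_onI)
  \<comment> \<open>The evaluation \<open>(p, y) \<mapsto> p y\<close> is not measurable for the product sigma-algebra on paths, so the time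
    is first rounded up to a grid; path continuity removes the rounding.\<close>
  define K :: "nat \<Rightarrow> real \<Rightarrow> nat" where "K n y = nat \<lceil>y * real (Suc n)\<rceil>" for n y
  define D :: "nat \<Rightarrow> real \<Rightarrow> real" where "D n y = real (K n y) / real (Suc n)" for n y
  have K[measurable]: "K n \<in> borel \<rightarrow>\<^sub>M count_space UNIV" for n
    unfolding K_def by measurable
  have D[measurable]: "D n \<in> borel_measurable borel" for n
    unfolding D_def by measurable
  have D_nonneg: "0 \<le> D n y" for n y
    by (simp add: D_def)
  have D_lim: "(\<lambda>n. D n y) \<longlonglongrightarrow> y" if "0 \<le> y" for y
  proof (rule tendsto_sandwich)
    have ineq: "y * real (Suc n) \<le> real (K n y)" "real (K n y) \<le> y * real (Suc n) + 1" for n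
      unfolding K_def using \<open>0 \<le> y\<close> by (simp_all add: of_nat_nat)
    show "\<forall>\<^sub>F n in sequentially. y \<le> D n y"
      using ineq(1) by (intro always_eventually) (simp add: D_def field_simps)
    have "D n y \<le> y + 1 / real (Suc n)" for n
      using divide_right_mono[OF ineq(2), of "real (Suc n)" n]
      by (simp add: D_def add_divide_distrib del: of_nat_Suc)
    then show "\<forall>\<^sub>F n in sequentially. D n y \<le> y + 1 / real (Suc n)"
      by simp
    show "(\<lambda>n. y + 1 / real (Suc n)) \<longlonglongrightarrow> y"
      using tendsto_add[OF tendsto_const LIMSEQ_inverse_real_of_nat, of y]
      by (simp add: inverse_eq_divide)
  qed simp
  have eval[measurable]: "(\<lambda>z. f (fst z (D n (h (snd z))))) \<in> borel_measurable (?S \<Otimes>\<^sub>M T)" for n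
    unfolding D_def
  \<comment> \<open>The rounded time takes countably many values; on each of them evaluation is a
    fixed coordinate of the path, hence measurable.\<close>
  proof (rule measurable_compose_countable[where g = "\<lambda>z. K n (h (snd z))"
        and f = "\<lambda>k z. f (fst z (real k / real (Suc n)))"])
    show "(\<lambda>z. f (fst z (real k / real (Suc n)))) \<in> borel_measurable (?S \<Otimes>\<^sub>M T)" for k
      by (intro measurable_compose[OF _ f] measurable_compose[OF measurable_fst]
          measurable_component_singleton) simp
  qed measurable
  interpret P: prob_space "distr M ?S ?path"
    by (rule prob_space_distr) (rule path)
  interpret Q: prob_space "distr M T Y"
    by (rule prob_space_distr) (rule Y)
  interpret PQ: pair_prob_space "distr M ?S ?path" "distr M T Y" ..
  have approx: "(\<integral>\<omega>. f (B (D n (h (Y \<omega>))) \<omega>) \<partial>M) = (\<integral>\<omega>. gaussian_mean f (D n (h (Y \<omega>))) \<partial>M)" for n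
  proof -
    let ?G = "\<lambda>p y. f (p (D n (h y)))"
    \<comment> \<open>With \<open>y\<close> frozen the rounded time is deterministic, so the law of
      the Brownian motion at one fixed time suffices. Independence makes the joint law a product,
      and Fubini then reinstates \<open>y\<close>.\<close>
    have inner: "(\<integral>p. ?G p y \<partial>distr M ?S ?path) = gaussian_mean f (D n (h y))" for y
    proof -
      have "(\<lambda>p. p (D n (h y))) \<in> ?S \<rightarrow>\<^sub>M borel"
        by (rule measurable_component_singleton) (simp add: D_nonneg)
      then have "(\<integral>p. ?G p y \<partial>distr M ?S ?path) = (\<integral>\<omega>. f (B (D n (h y)) \<omega>) \<partial>M)"
        by (subst integral_distr) (auto simp: D_nonneg)
      then show ?thesis
        by (simp add: brownian_motion_expectation[OF B D_nonneg f])
    qed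
    have int: "integrable (distr M ?S ?path \<Otimes>\<^sub>M distr M T Y) (case_prod ?G)"
      by (rule PQ.integrable_const_bound[where B = C]) (use eval in \<open>auto simp: bound case_prod_beta\<close>)
    have "(\<integral>\<omega>. f (B (D n (h (Y \<omega>))) \<omega>) \<partial>M) = (\<integral>\<omega>. case_prod ?G (?path \<omega>, Y \<omega>) \<partial>M)"
      by (simp add: D_nonneg)
    also have "\<dots> = (\<integral>z. case_prod ?G z \<partial>(distr M ?S ?path \<Otimes>\<^sub>M distr M T Y))"
      unfolding joint by (rule integral_distr[symmetric]) (use eval in \<open>auto simp: case_prod_beta\<close>)
    also have "\<dots> = (\<integral>y. \<integral>p. ?G p y \<partial>distr M ?S ?path \<partial>distr M T Y)"
      by (rule PQ.integral_snd[symmetric]) (rule int)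
    also have "\<dots> = (\<integral>y. gaussian_mean f (D n (h y)) \<partial>distr M T Y)"
      unfolding inner ..
    also have "\<dots> = (\<integral>\<omega>. gaussian_mean f (D n (h (Y \<omega>))) \<partial>M)"
      by (rule integral_distr) measurable
    finally show ?thesis .
  qed
  have "(\<lambda>n. \<integral>\<omega>. f (B (D n (h (Y \<omega>))) \<omega>) \<partial>M) \<longlonglongrightarrow> (\<integral>\<omega>. f (B (h (Y \<omega>)) \<omega>) \<partial>M)"
  proof (rule integral_dominated_convergence[where w = "\<lambda>_. C"])
    have "(\<lambda>\<omega>. f (fst (?path \<omega>, Y \<omega>) (D n (h (snd (?path \<omega>, Y \<omega>)))))) \<in> borel_measurable M" for n
      by (rule measurable_compose[OF _ eval]) measurable
    then show "(\<lambda>\<omega>. f (B (D n (h (Y \<omega>))) \<omega>)) \<in> borel_measurable M" for n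
      by (simp add: D_nonneg)
    show "AE \<omega> in M. (\<lambda>n. f (B (D n (h (Y \<omega>))) \<omega>)) \<longlonglongrightarrow> f (B (h (Y \<omega>)) \<omega>)"
      using paths
    proof eventually_elim
      case (elim \<omega>)
      have "(\<lambda>n. B (D n (h (Y \<omega>))) \<omega>) \<longlonglongrightarrow> B (h (Y \<omega>)) \<omega>"
        by (rule continuous_on_tendsto_compose[OF elim D_lim[OF nonneg]])
          (auto simp: nonneg D_nonneg)
      then show ?case
        by (rule continuous_on_tendsto_compose[OF cont]) auto
    qed
  qed (use bound in auto)
  moreover have "(\<lambda>n. \<integral>\<omega>. gaussian_mean f (D n (h (Y \<omega>))) \<partial>M) \<longlonglongrightarrow> (\<integral>\<omega>. gaussian_mean f (h (Y \<omega>)) \<partial>M)"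
  proof (rule integral_dominated_convergence[where w = "\<lambda>_. C"])
    show "AE \<omega> in M. (\<lambda>n. gaussian_mean f (D n (h (Y \<omega>)))) \<longlonglongrightarrow> gaussian_mean f (h (Y \<omega>))"
      by (intro AE_I2 continuous_on_tendsto_compose[OF cont_mean D_lim[OF nonneg]]) auto
    show "AE \<omega> in M. norm (gaussian_mean f (D n (h (Y \<omega>)))) \<le> C" for n
      using gaussian_mean_bound[OF bound] by simp
  qed auto
  ultimately show ?thesis
    unfolding approx by (rule LIMSEQ_unique)
qed

text \<open>The random time is read off the path of \<open>B2\<close> by the functional
  \<open>\<bar>p t\<bar>\<close>. Measurability of the composition is a hypothesis because
  \<open>B1\<close> is assumed measurable only at each fixed time; in the theorem it comes from the
  existence of the density.\<close>

lemma iterated_process_expectation: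
  fixes f :: "real \<Rightarrow> real"
  assumes B1: "standard_brownian_motion M B1" and B2: "fractional_brownian_motion M H B2"
    and indep: "independent_processes M B1 B2" and "0 < t"
    and X: "(\<lambda>\<omega>. B1 \<bar>B2 t \<omega>\<bar> \<omega>) \<in> borel_measurable M"
    and cont: "continuous_on UNIV f" and bound: "\<And>x. \<bar>f x\<bar> \<le> C"
  shows "(\<integral>\<omega>. f (B1 \<bar>B2 t \<omega>\<bar> \<omega>) \<partial>M)
      = (\<integral>n. gaussian_mean f (t powr H * \<bar>n\<bar>) \<partial>std_normal_distribution)"
proof -
  have [measurable]: "gaussian_mean f \<in> borel_measurable borel"
    by (rule borel_measurable_continuous_onI[OF continuous_on_gaussian_mean[OF cont bound]])
  have h: "(\<lambda>p. \<bar>p t\<bar>) \<in> Pi\<^sub>M {0..} (\<lambda>_. borel) \<rightarrow>\<^sub>M (borel :: real measure)"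
    by (intro borel_measurable_abs measurable_component_singleton) (use \<open>0 < t\<close> in simp)
  have "(\<integral>\<omega>. f (B1 \<bar>B2 t \<omega>\<bar> \<omega>) \<partial>M) = (\<integral>\<omega>. gaussian_mean f \<bar>B2 t \<omega>\<bar> \<partial>M)"
    using brownian_motion_at_independent_time[OF B1 indep[unfolded independent_processes_def] h _ _ cont bound]
      X \<open>0 < t\<close> by simp
  also have "\<dots> = (\<integral>n. gaussian_mean f \<bar>t powr H * n\<bar> \<partial>std_normal_distribution)"
    by (rule fractional_brownian_motion_expectation[OF B2 \<open>0 < t\<close>]) measurable
  finally show ?thesis
    by (simp add: abs_mult)
qed

section \<open>Test functions, distributional derivatives and the equation\<close>

lemma test_function_has_real_derivative:
  assumes "test_function \<phi>"
  shows "((deriv ^^ n) \<phi> has_real_derivative (deriv ^^ Suc n) \<phi> x) (at x)"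
  using assms by (simp add: test_function_def field_differentiable_derivI)

text \<open>Off the closed support all derivatives vanish, by induction on the order, because the
  complement is open; on the compact support continuity gives a bound.\<close>

lemma test_function_bounded:
  assumes \<phi>: "test_function \<phi>"
  obtains C where "\<And>x. \<bar>(deriv ^^ n) \<phi> x\<bar> \<le> C"
proof -
  let ?K = "closure {x. \<phi> x \<noteq> 0}"
  have zero: "(deriv ^^ n) \<phi> x = 0" if "x \<notin> ?K" for n x
    using that
  proof (induction n arbitrary: x)
    case 0
    then show ?case
      using closure_subset[of "{x. \<phi> x \<noteq> 0}"] by auto
  next
    case (Suc n)
    have "open (- ?K)" "x \<in> - ?K"
      using Suc.prems by auto
    then have "((deriv ^^ n) \<phi> has_real_derivative 0) (at x)"
      by (rule has_field_derivative_transform_within_open[OF DERIV_const]) (use Suc.IH in auto)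
    then show ?case
      by (simp add: DERIV_imp_deriv)
  qed
  have "continuous_on ?K ((deriv ^^ n) \<phi>)"
    by (intro continuous_at_imp_continuous_on ballI
        DERIV_isCont[OF test_function_has_real_derivative[OF \<phi>]])
  then have "bounded ((deriv ^^ n) \<phi> ` ?K)"
    using \<phi> by (intro compact_imp_bounded compact_continuous_image) (simp_all add: test_function_def)
  then obtain C where C: "\<And>x. x \<in> ?K \<Longrightarrow> \<bar>(deriv ^^ n) \<phi> x\<bar> \<le> C"
    by (auto simp: bounded_iff)
  show thesis
  \<comment> \<open>The absolute value matters for an empty support, where \<open>C\<close> is
    unconstrained and may be negative.\<close>
  proof (rule that)
    show "\<bar>(deriv ^^ n) \<phi> x\<bar> \<le> \<bar>C\<bar>" for x
      by (cases "x \<in> ?K") (use C[of x] zero[of x n] in auto)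
  qed
qed

lemma distribution_deriv_funpow:
  "(distribution_deriv ^^ n) T \<phi> = (- 1) ^ n * T ((deriv ^^ n) \<phi>)"
proof (induction n arbitrary: \<phi>)
  case (Suc n)
  then show ?case
    by (simp add: distribution_deriv_def funpow_swap1)
qed simp


theorem mainTheorem3:
  fixes M :: "'a measure" and H :: real
    and B1 B2 :: "real \<Rightarrow> 'a \<Rightarrow> real" and q :: "real \<Rightarrow> real \<Rightarrow> real"
  assumes "0 < H" and "H < 1"
    and "prob_space M"
    and "standard_brownian_motion M B1"
    and "fractional_brownian_motion M H B2"
    and "independent_processes M B1 B2"
    and "\<And>x t. 0 < t \<Longrightarrow> 0 \<le> q x t"
    and "\<And>t. 0 < t \<Longrightarrow>
           distributed M lborel (\<lambda>\<omega>. B1 \<bar>B2 t \<omega>\<bar> \<omega>) (\<lambda>x. ennreal (q x t))"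
  shows "(\<forall>t>0. \<exists>dq_dt :: distribution.
            has_param_derivative (\<lambda>s. regular_distribution (\<lambda>x. q x s)) dq_dt t \<and>
            eq_distribution
              (\<lambda>\<phi>. t * dq_dt \<phi>)
              (\<lambda>\<phi>. H / 2 ^ 2 * t powr (2 * H)
                      * (distribution_deriv ^^ 4) (regular_distribution (\<lambda>x. q x t)) \<phi>
                    + H * t powr H / sqrt (2 * pi) * (distribution_deriv ^^ 2) dirac_delta \<phi>))
       \<and> (\<forall>\<tau> :: nat \<Rightarrow> real. (\<forall>n. 0 < \<tau> n) \<and> \<tau> \<longlonglongrightarrow> 0 \<longrightarrow>
            weak_conv_m (\<lambda>n. density lborel (\<lambda>x. ennreal (q x (\<tau> n)))) (return borel 0))"
proof -
  interpret prob_space M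
    by fact
  have X: "(\<lambda>\<omega>. B1 \<bar>B2 t \<omega>\<bar> \<omega>) \<in> borel_measurable M" if "0 < t" for t
    using distributed_measurable[OF assms(8)[OF that]] by simp
  \<comment> \<open>Stated for all bounded continuous functions, since it is applied both to
    derivatives of test functions and to continuous step functions.\<close>
  have action: "regular_distribution (\<lambda>x. q x t) f
      = (\<integral>n. gaussian_mean f (t powr H * \<bar>n\<bar>) \<partial>std_normal_distribution)"
    if "0 < t" "continuous_on UNIV f" "\<And>x. \<bar>f x\<bar> \<le> C" for t f C
  proof -
    have "regular_distribution (\<lambda>x. q x t) f = (\<integral>\<omega>. f (B1 \<bar>B2 t \<omega>\<bar> \<omega>) \<partial>M)"
      unfolding regular_distribution_def
      by (rule distributed_integral[OF assms(8)])
        (use that assms(7) borel_measurable_continuous_onI in auto)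
    also have "\<dots> = (\<integral>n. gaussian_mean f (t powr H * \<bar>n\<bar>) \<partial>std_normal_distribution)"
      by (rule iterated_process_expectation[OF assms(4,5,6) \<open>0 < t\<close> X[OF \<open>0 < t\<close>] that(2,3)])
    finally show ?thesis .
  qed
  have equation: "\<exists>dq_dt :: distribution.
      has_param_derivative (\<lambda>s. regular_distribution (\<lambda>x. q x s)) dq_dt t \<and>
      eq_distribution (\<lambda>\<phi>. t * dq_dt \<phi>)
        (\<lambda>\<phi>. H / 2 ^ 2 * t powr (2 * H)
                * (distribution_deriv ^^ 4) (regular_distribution (\<lambda>x. q x t)) \<phi>
              + H * t powr H / sqrt (2 * pi) * (distribution_deriv ^^ 2) dirac_delta \<phi>)"
    (is "\<exists>dq_dt. _ dq_dt \<and> eq_distribution _ ?R")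
    if "0 < t" for t
  \<comment> \<open>The witness is the right-hand side divided by \<open>t\<close>: the equation
    becomes trivial, and all content moves to the claim that this is the time derivative.\<close>
  proof (intro exI conjI)
    show "eq_distribution (\<lambda>\<phi>. t * (?R \<phi> / t)) ?R"
      using \<open>0 < t\<close> by (simp add: eq_distribution_def)
    show "has_param_derivative (\<lambda>s. regular_distribution (\<lambda>x. q x s)) (\<lambda>\<phi>. ?R \<phi> / t) t"
      unfolding has_param_derivative_def
    proof (intro allI impI)
      fix \<phi> assume \<phi>: "test_function \<phi>"
      define f where "f n = (deriv ^^ n) \<phi>" for n
      have deriv: "(f n has_real_derivative f (Suc n) x) (at x)" for n x
        unfolding f_def by (rule test_function_has_real_derivative[OF \<phi>])
      have cont: "continuous_on UNIV (f n)" for n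
        by (intro continuous_at_imp_continuous_on ballI DERIV_isCont[OF deriv])
      have "\<exists>C. \<forall>x. \<bar>f n x\<bar> \<le> C" for n
        unfolding f_def by (rule test_function_bounded[OF \<phi>, of n]) blast
      then obtain C where bound: "\<bar>f n x\<bar> \<le> C n" for n x
        by metis
      let ?F = "\<lambda>n \<sigma>. \<integral>y. gaussian_mean (f n) (\<sigma> * \<bar>y\<bar>) \<partial>std_normal_distribution"
      have "0 < t powr H"
        using \<open>0 < t\<close> by simp
      note DERIV_chain2[OF has_real_derivative_gaussian_mean_abs[where f = f and C = C, OF deriv bound this]
          has_real_derivative_powr[OF \<open>0 < t\<close>]]
      then have D: "((\<lambda>s. regular_distribution (\<lambda>x. q x s) \<phi>) has_real_derivative
          (f 2 0 / sqrt (2 * pi) + t powr H / 4 * ?F 4 (t powr H)) * (H * t powr (H - 1))) (at t)"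
      \<comment> \<open>The expectation formula holds only at positive times, so the two functions
        of \<open>s\<close> are identified on the open half line around \<open>t\<close>.\<close>
      proof (rule has_field_derivative_transform_within_open[OF _ open_greaterThan[of 0]])
        show "?F 0 (s powr H) = regular_distribution (\<lambda>x. q x s) \<phi>" if "s \<in> {0<..}" for s
          using action[OF _ cont bound, of s 0] that by (simp add: f_def)
      qed (use \<open>0 < t\<close> in simp)
      \<comment> \<open>Both distributional derivatives in the equation have even order, so the
        signs from moving derivatives onto the test function disappear.\<close>
      have F4: "(distribution_deriv ^^ 4) (regular_distribution (\<lambda>x. q x t)) \<phi> = ?F 4 (t powr H)"
        using action[OF \<open>0 < t\<close> cont bound, of 4] by (simp add: distribution_deriv_funpow f_def[of 4])
      have f2: "(distribution_deriv ^^ 2) dirac_delta \<phi> = f 2 0"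
        by (simp add: distribution_deriv_funpow f_def[of 2] dirac_delta_def)
      have powr: "t powr (H - 1) = t powr H / t" "t powr (2 * H) = t powr H * t powr H"
        using \<open>0 < t\<close> by (simp_all add: powr_diff powr_add[symmetric])
      show "((\<lambda>s. regular_distribution (\<lambda>x. q x s) \<phi>) has_real_derivative ?R \<phi> / t) (at t)"
        by (rule DERIV_cong[OF D]) (unfold F4 f2 powr, simp add: field_simps)
    qed
  qed
  have "weak_conv_m (\<lambda>n. density lborel (\<lambda>x. ennreal (q x (\<tau> n)))) (return borel 0)"
    if pos: "\<And>n. 0 < \<tau> n" and lim: "\<tau> \<longlonglongrightarrow> 0" for \<tau> :: "nat \<Rightarrow> real"
  \<comment> \<open>It suffices to test against the continuous piecewise linear steps
    \<open>cts_step a b\<close>, which are bounded by 1 and so within reach of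
    \<open>action\<close>. Their expectations converge because the scale
    \<open>\<tau> n powr H\<close> tends to 0, which uses \<open>0 < H\<close>.\<close>
  proof (rule integral_cts_step_conv_imp_weak_conv)
    have "density lborel (\<lambda>x. ennreal (q x (\<tau> n))) = distr M borel (\<lambda>\<omega>. B1 \<bar>B2 (\<tau> n) \<omega>\<bar> \<omega>)" for n
      using distributed_distr_eq_density[OF assms(8)[OF pos]] by (simp cong: distr_cong)
    then show "real_distribution (density lborel (\<lambda>x. ennreal (q x (\<tau> n))))" for n
      using X[OF pos] by simp
    show "real_distribution (return borel 0)"
      by (intro real_distribution.intro prob_space_return real_distribution_axioms.intro) auto
    fix a b :: real assume "a < b"
    let ?f = "cts_step a b"
    have cont: "continuous_on UNIV ?f"
      using cts_step_uniformly_continuous[OF \<open>a < b\<close>] by (rule uniformly_continuous_imp_continuous)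
    have bound: "\<bar>?f x\<bar> \<le> 1" for x
      using \<open>a < b\<close> by (auto simp: cts_step_def)
    have cont_mean: "continuous_on UNIV (gaussian_mean ?f)"
      by (rule continuous_on_gaussian_mean[OF cont bound])
    have [measurable]: "?f \<in> borel_measurable borel" "gaussian_mean ?f \<in> borel_measurable borel"
      using cont cont_mean by (auto intro: borel_measurable_continuous_onI)
    interpret \<gamma>: prob_space std_normal_distribution
      using real_dist_normal_dist by (simp add: real_distribution_def)
    have powr_lim: "(\<lambda>n. \<tau> n powr H) \<longlonglongrightarrow> 0"
      using lim pos \<open>0 < H\<close> by (intro tendsto_zero_powrI[OF lim tendsto_const]) (auto simp: less_imp_le)
    have "(\<lambda>n. \<integral>y. gaussian_mean ?f (\<tau> n powr H * \<bar>y\<bar>) \<partial>std_normal_distribution)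
        \<longlonglongrightarrow> (\<integral>y. gaussian_mean ?f (0 * \<bar>y\<bar>) \<partial>std_normal_distribution)"
    proof (rule integral_dominated_convergence[where w = "\<lambda>_. 1"])
      show "AE y in std_normal_distribution.
          (\<lambda>n. gaussian_mean ?f (\<tau> n powr H * \<bar>y\<bar>)) \<longlonglongrightarrow> gaussian_mean ?f (0 * \<bar>y\<bar>)"
        by (intro AE_I2 continuous_on_tendsto_compose[OF cont_mean] tendsto_intros powr_lim) auto
      show "AE y in std_normal_distribution. norm (gaussian_mean ?f (\<tau> n powr H * \<bar>y\<bar>)) \<le> 1" for n
        using gaussian_mean_bound[OF bound] by simp
    qed auto
    also have "(\<integral>y. gaussian_mean ?f (0 * \<bar>y\<bar>) \<partial>std_normal_distribution) = ?f 0"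
      using \<gamma>.prob_space by simp
    also have "\<dots> = (\<integral>x. ?f x \<partial>return borel 0)"
      by (rule integral_return[symmetric]) auto
    also have "(\<lambda>n. \<integral>y. gaussian_mean ?f (\<tau> n powr H * \<bar>y\<bar>) \<partial>std_normal_distribution)
        = (\<lambda>n. \<integral>x. ?f x \<partial>density lborel (\<lambda>x. ennreal (q x (\<tau> n))))"
    proof
      fix n
      have "(\<lambda>x. q x (\<tau> n)) \<in> borel_measurable lborel"
        using distributed_real_measurable[OF _ assms(8)[OF pos]] assms(7)[OF pos] by auto
      then show "(\<integral>y. gaussian_mean ?f (\<tau> n powr H * \<bar>y\<bar>) \<partial>std_normal_distribution)
          = (\<integral>x. ?f x \<partial>density lborel (\<lambda>x. ennreal (q x (\<tau> n))))"
        using action[OF pos cont bound, of n] assms(7)[OF pos]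
        by (subst integral_density) (auto simp: regular_distribution_def)
    qed
    finally show "(\<lambda>n. \<integral>x. ?f x \<partial>density lborel (\<lambda>x. ennreal (q x (\<tau> n))))
        \<longlonglongrightarrow> (\<integral>x. ?f x \<partial>return borel 0)" .
  qed
  with equation show ?thesis
    by blast
qed

end
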